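(* Let $h\geq 4$ be an integer, let $n=2^h$, and let $\overline{\Gamma_{2^h}}=\overline{C_{2^h}(1,2,2^2,\ldots,2^{h-1})}$ be the complement of the circulant graph $C_{2^h}(1,2,2^2,\ldots,2^{h-1})$. Then its edge-forwarding index satisfies $$\frac{2(n+2h-2)}{n-2h}\leq \pi(\overline{\Gamma_{2^h}})\leq 6h-1.$$
   Context: For $S\subseteq\mathbb{Z}_n\setminus\{0\}$, the circulant graph $C_n(S)$ is the simple undirected graph with vertex set $\mathbb{Z}_n=\{0,1,\ldots,n-1\}$ and edge set $\{\{g,g+s\}: g\in\mathbb{Z}_n, s\in S\}$ (addition mod $n$); $C_n(s_1,\ldots,s_t)$ means $C_n(\{s_1,\ldots,s_t\})$. $\overline{\Gamma}$ denotes the complement of $\Gamma$. A routing $R$ of a connected graph $\Gamma$ on $n$ vertices is a set of $n(n-1)$ elementary (i.e. simple) paths $R(x,y)$, one from $x$ to $y$ for every ordered pair $(x,y)$ of distinct vertices. The load of an edge $e$ in $R$ is the number of paths of $R$ passing through $e$ (in either direction), and $\pi(\Gamma,R)$ is the maximum load over all edges of $\Gamma$. The edge-forwarding index is $\pi(\Gamma)=\min_R\pi(\Gamma,R)$, the minimum over all routings $R$ of $\Gamma$. *)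

theory Defs
  imports Complex_Main
begin

record 'a graph =
  verts :: "'a set"
  edges :: "'a set set"

definition complement :: "'a graph \<Rightarrow> 'a graph" where
  "complement G =
    \<lparr>verts = verts G,
     edges = {{x, y} | x y. x \<in> verts G \<and> y \<in> verts G \<and> x \<noteq> y \<and> {x, y} \<notin> edges G}\<rparr>"

(* The residues modulo n are represented by 0, ..., n - 1; the connection set S is
   meant to be a subset of {1..<n}, which makes the graph simple (no loops). *)
definition circulant :: "nat \<Rightarrow> nat set \<Rightarrow> nat graph" where
  "circulant n S =
    \<lparr>verts = {..<n}, edges = {{g, (g + s) mod n} | g s. g < n \<and> s \<in> S}\<rparr>"

definition path_edges :: "'a list \<Rightarrow> 'a set set" where
  "path_edges p = {{p ! i, p ! Suc i} | i. Suc i < length p}"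

definition elementary_path :: "'a graph \<Rightarrow> 'a \<Rightarrow> 'a \<Rightarrow> 'a list \<Rightarrow> bool" where
  "elementary_path G x y p \<longleftrightarrow>
    p \<noteq> [] \<and> hd p = x \<and> last p = y \<and> distinct p \<and>
    set p \<subseteq> verts G \<and> path_edges p \<subseteq> edges G"

(* A routing is given as a function of the ordered pair (x, y); its values outside the
   pairs of distinct vertices are irrelevant. *)
definition routing :: "'a graph \<Rightarrow> ('a \<Rightarrow> 'a \<Rightarrow> 'a list) \<Rightarrow> bool" where
  "routing G R \<longleftrightarrow>
    (\<forall>x\<in>verts G. \<forall>y\<in>verts G. x \<noteq> y \<longrightarrow> elementary_path G x y (R x y))"

definition load :: "'a graph \<Rightarrow> ('a \<Rightarrow> 'a \<Rightarrow> 'a list) \<Rightarrow> 'a set \<Rightarrow> nat" where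
  "load G R e =
    card {(x, y). x \<in> verts G \<and> y \<in> verts G \<and> x \<noteq> y \<and> e \<in> path_edges (R x y)}"

(* Meaningful for finite graphs with at least one edge. *)
definition max_load :: "'a graph \<Rightarrow> ('a \<Rightarrow> 'a \<Rightarrow> 'a list) \<Rightarrow> nat" where
  "max_load G R = Max (load G R ` edges G)"

(* The infimum of a nonempty set of naturals is its minimum; a routing exists exactly
   when G is connected. For a disconnected G the value is the junk value Inf {} = 0. *)
definition edge_forwarding_index :: "'a graph \<Rightarrow> nat" where
  "edge_forwarding_index G = Inf {max_load G R | R. routing G R}"

end

theory Submission
  imports Defs
begin

text \<open>
  Write \<open>J\<close> for the set of the \<open>2 h - 1\<close> residues \<open>\<plusminus> 2 ^ i\<close> modulo \<open>n = 2 ^ h\<close>, so that two distinct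
  vertices of the complement are adjacent iff their difference is not in \<open>J\<close>.

  Lower bound: a path between adjacent vertices uses at least one edge, any other path at least
  two. The loads of a routing therefore add up to at least the number of ordered pairs of distinct
  vertices plus the number of non-adjacent ones, and some edge carries at least the average. Counting
  the edges as ordered pairs turns this into the stated quotient
  (\<open>two_pairs_le_max_load_mult_edges\<close>, \<open>card_edges_complement_circulant\<close>).

  Upper bound: the routing joins adjacent vertices by their edge, and sends \<open>x\<close> to \<open>x + t\<close> with
  \<open>t \<in> J\<close> through \<open>x + c t\<close>, where neither \<open>c t\<close> nor \<open>t - c t\<close> is \<open>0\<close> or in \<open>J\<close>. Such a splitting of
  every power of two exists because an odd residue other than \<open>\<plusminus>1\<close> is never in \<open>J\<close>:
  \<open>2 = 5 - 3\<close>, \<open>4 = 7 - 3\<close>, \<open>2 ^ i = 3 + (2 ^ i - 3)\<close>, and for the odd number \<open>1\<close> one takes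
  \<open>1 = 6 - 5\<close>. The routing is invariant under rotation, so a fixed edge \<open>{u, v}\<close> is the first edge of
  at most one detour for each \<open>t\<close>, and the second edge of at most one: two would
  traverse it in opposite directions, so that \<open>v - u\<close> and \<open>u - v\<close> both equal \<open>c t\<close> (or both equal \<open>t - c t\<close>).
  This forces \<open>v - u = n / 2\<close>, but \<open>n / 2\<close> is in \<open>J\<close>. Together with the two direct
  paths each load is at most \<open>2 + 2 (2 h - 1) = 4 h\<close>, which does not exceed \<open>6 h - 1\<close>.
\<close>

section \<open>Loads of routings and the averaging bound\<close>

definition ordered_pairs :: "'a set \<Rightarrow> ('a \<times> 'a) set" where
  "ordered_pairs V = {(x, y). x \<in> V \<and> y \<in> V \<and> x \<noteq> y}"

lemma finite_ordered_pairs [simp]: "finite V \<Longrightarrow> finite (ordered_pairs V)"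
  by (rule finite_subset[of _ "V \<times> V"]) (auto simp: ordered_pairs_def)

lemma card_ordered_pairs:
  assumes "finite V"
  shows "card (ordered_pairs V) = card V * (card V - 1)"
proof -
  have "ordered_pairs V = (SIGMA x:V. V - {x})"
    by (auto simp: ordered_pairs_def)
  then show ?thesis
    using assms by simp
qed

lemma card_adjacent_pairs:
  assumes "finite E" and two: "\<And>e. e \<in> E \<Longrightarrow> card e = 2"
  shows "card {(x, y). x \<noteq> y \<and> {x, y} \<in> E} = 2 * card E"
proof -
  let ?B = "\<lambda>e. {(x, y). x \<noteq> y \<and> {x, y} = e}"
  have B: "card (?B e) = 2 \<and> finite (?B e)" if e: "e \<in> E" for e
  proof -
    obtain a b where ab: "e = {a, b}" "a \<noteq> b"
      using two[OF e] unfolding card_2_iff by blast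
    then have "?B e = {(a, b), (b, a)}"
      by (auto simp: doubleton_eq_iff)
    then show ?thesis
      using ab by simp
  qed
  have "{(x, y). x \<noteq> y \<and> {x, y} \<in> E} = (\<Union>e\<in>E. ?B e)"
    by auto
  also have "card \<dots> = (\<Sum>e\<in>E. card (?B e))"
    using assms(1) B by (intro card_UN_disjoint) auto
  also have "\<dots> = 2 * card E"
    using B by simp
  finally show ?thesis .
qed

lemma two_le_card_path_edges:
  assumes "elementary_path G x y p" "x \<noteq> y" "{x, y} \<notin> edges G" "finite (path_edges p)"
  shows "2 \<le> card (path_edges p)"
proof -
  have p: "p \<noteq> []" "hd p = x" "last p = y" "distinct p" "path_edges p \<subseteq> edges G"
    using assms(1) by (auto simp: elementary_path_def)
  have "2 < length p"
  proof (rule ccontr)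
    assume "\<not> 2 < length p"
    with p have "p = [x] \<or> p = [x, y]"
      by (cases p; cases "tl p"; cases "tl (tl p)") auto
    then show False
    proof
      assume "p = [x]"
      then show False using p assms(2) by simp
    next
      assume "p = [x, y]"
      then have "{x, y} \<in> path_edges p"
        by (auto simp: path_edges_def intro!: exI[of _ 0])
      then show False using p assms(3) by auto
    qed
  qed
  then have sub: "{{p ! 0, p ! 1}, {p ! 1, p ! 2}} \<subseteq> path_edges p"
    by (force simp: path_edges_def numeral_2_eq_2)
  have "p ! 0 \<noteq> p ! 1" "p ! 0 \<noteq> p ! 2"
    using \<open>2 < length p\<close> \<open>distinct p\<close> nth_eq_iff_index_eq[of p 0 1] nth_eq_iff_index_eq[of p 0 2]
    using \<open>p \<noteq> []\<close> by auto
  then have "{p ! 0, p ! 1} \<noteq> {p ! 1, p ! 2}"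
    by (auto simp: doubleton_eq_iff)
  then show ?thesis
    using card_mono[OF assms(4) sub] by simp
qed

lemma one_le_card_path_edges:
  assumes "elementary_path G x y p" "x \<noteq> y" "finite (path_edges p)"
  shows "1 \<le> card (path_edges p)"
proof -
  have "Suc 0 < length p"
    using assms(1,2) by (cases p; cases "tl p") (auto simp: elementary_path_def)
  then have "{p ! 0, p ! Suc 0} \<in> path_edges p"
    by (force simp: path_edges_def)
  then show ?thesis
    using assms(3) by (metis One_nat_def Suc_leI card_gt_0_iff empty_iff)
qed

text \<open>Double counting of the incidences between edges and paths of the routing. An adjacent pair
  may contribute a single edge; adding \<open>1\<close> for each of the \<open>2 |E|\<close> adjacent ordered pairs gives every
  pair a contribution of at least \<open>2\<close>.\<close>

lemma two_pairs_le_max_load_mult_edges: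
  assumes "finite (verts G)" and "finite (edges G)" and R: "routing G R"
    and two: "\<And>e. e \<in> edges G \<Longrightarrow> card e = 2"
  shows "2 * (card (verts G) * (card (verts G) - 1)) \<le> (max_load G R + 2) * card (edges G)"
proof -
  let ?P = "ordered_pairs (verts G)" and ?E = "edges G"
  let ?adj = "\<lambda>p. if {fst p, snd p} \<in> ?E then 1 else (0::nat)"
  let ?pe = "\<lambda>p. path_edges (R (fst p) (snd p))"
  have fin: "finite ?P" using assms by simp
  have load: "load G R e = (\<Sum>p\<in>?P. of_bool (e \<in> ?pe p))" for e
  proof -
    have "load G R e = card {p \<in> ?P. e \<in> ?pe p}"
      unfolding load_def by (rule arg_cong[of _ _ card]) (auto simp: ordered_pairs_def)
    then show ?thesis
      using fin by (simp add: of_bool_def sum.If_cases Int_def)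
  qed
  have each: "2 \<le> (\<Sum>e\<in>?E. of_bool (e \<in> ?pe p)) + ?adj p" if "p \<in> ?P" for p
  proof -
    have path: "elementary_path G (fst p) (snd p) (R (fst p) (snd p))" "fst p \<noteq> snd p"
      using R that by (auto simp: routing_def ordered_pairs_def)
    then have sub: "?pe p \<subseteq> ?E"
      by (auto simp: elementary_path_def)
    then have finp: "finite (?pe p)"
      using assms(2) finite_subset by blast
    have "(\<Sum>e\<in>?E. of_bool (e \<in> ?pe p)) = card (?pe p)"
      using assms(2) sub by (simp add: of_bool_def sum.If_cases Int_absorb1)
    then show ?thesis
      using one_le_card_path_edges[OF path finp] two_le_card_path_edges[OF path _ finp] by auto
  qed
  have "{p \<in> ?P. {fst p, snd p} \<in> ?E} \<subseteq> {(x, y). x \<noteq> y \<and> {x, y} \<in> ?E}"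
    by (auto simp: ordered_pairs_def)
  moreover have "finite {(x, y). x \<noteq> y \<and> {x, y} \<in> ?E}"
  proof (rule finite_subset)
    show "{(x, y). x \<noteq> y \<and> {x, y} \<in> ?E} \<subseteq> \<Union>?E \<times> \<Union>?E" by auto
    have "finite e" if "e \<in> ?E" for e
      using two[OF that] card.infinite by fastforce
    then show "finite (\<Union>?E \<times> \<Union>?E)" using assms(2) by auto
  qed
  ultimately have "card {p \<in> ?P. {fst p, snd p} \<in> ?E} \<le> 2 * card ?E"
    using card_adjacent_pairs[OF assms(2) two] by (metis (no_types, lifting) card_mono)
  then have adj: "sum ?adj ?P \<le> 2 * card ?E"
    using fin by (simp add: sum.If_cases Int_def)
  have "2 * card ?P \<le> (\<Sum>p\<in>?P. (\<Sum>e\<in>?E. of_bool (e \<in> ?pe p)) + ?adj p)"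
    using sum_mono[of ?P "\<lambda>_. 2" "\<lambda>p. (\<Sum>e\<in>?E. of_bool (e \<in> ?pe p)) + ?adj p"] each
    by (simp add: mult.commute)
  also have "\<dots> = (\<Sum>e\<in>?E. load G R e) + sum ?adj ?P"
    unfolding load sum.distrib by (subst sum.swap) simp
  also have "\<dots> \<le> card ?E * max_load G R + 2 * card ?E"
    using assms(2) adj
    by (intro add_mono sum_bounded_above[of ?E _ "max_load G R", simplified])
       (auto simp: max_load_def)
  finally show ?thesis
    using card_ordered_pairs[OF assms(1)] by (simp add: algebra_simps)
qed

text \<open>The index is an infimum over all routings, so it is attained once a single routing is known.\<close>

lemma edge_forwarding_index_attained:
  assumes "routing G R"
  obtains R' where "routing G R'" "edge_forwarding_index G = max_load G R'"
proof -
  have "edge_forwarding_index G \<in> {max_load G R | R. routing G R}"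
    unfolding edge_forwarding_index_def using assms by (intro Inf_nat_def1) auto
  then show ?thesis using that by blast
qed

lemma edge_forwarding_index_le:
  assumes "routing G R" "finite (edges G)" "edges G \<noteq> {}"
    and "\<And>e. e \<in> edges G \<Longrightarrow> load G R e \<le> b"
  shows "edge_forwarding_index G \<le> b"
proof -
  have "edge_forwarding_index G \<le> max_load G R"
    unfolding edge_forwarding_index_def using assms(1) by (intro cInf_lower) auto
  also have "\<dots> \<le> b"
    using assms(2-4) by (simp add: max_load_def)
  finally show ?thesis .
qed

section \<open>Complements of circulant graphs\<close>

text \<open>The residues of the jumps \<open>\<plusminus> s\<close>. Integers are used so that differences of vertices can be
  written without truncation.\<close>

definition jumps :: "nat \<Rightarrow> nat set \<Rightarrow> int set" where
  "jumps n S = {t \<in> {0..<int n}. \<exists>s\<in>S. int n dvd t - int s \<or> int n dvd t + int s}"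

lemma finite_jumps [simp]: "finite (jumps n S)"
  by (rule finite_subset[of _ "{0..<int n}"]) (auto simp: jumps_def)

lemma mod_in_jumps_iff:
  assumes "n > 0"
  shows "z mod int n \<in> jumps n S \<longleftrightarrow> (\<exists>s\<in>S. int n dvd z - int s \<or> int n dvd z + int s)"
proof -
  have "int n dvd z mod int n - int s \<longleftrightarrow> int n dvd z - int s"
    "int n dvd z mod int n + int s \<longleftrightarrow> int n dvd z + int s" for s
    unfolding dvd_eq_mod_eq_0 mod_diff_left_eq mod_add_left_eq by (rule refl)+
  then show ?thesis
    using assms by (simp add: jumps_def)
qed

lemma nat_eq_add_mod_iff:
  fixes x y s n :: nat
  assumes "y < n"
  shows "y = (x + s) mod n \<longleftrightarrow> int n dvd (int y - int x) - int s"
proof -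
  have "y = (x + s) mod n \<longleftrightarrow> int y mod int n = (int x + int s) mod int n"
    using assms by (metis mod_less of_nat_add of_nat_eq_iff zmod_int)
  also have "\<dots> \<longleftrightarrow> int n dvd (int y - int x) - int s"
    by (simp add: mod_eq_dvd_iff algebra_simps)
  finally show ?thesis .
qed

lemma edge_circulant_iff:
  assumes "x < n" "y < n"
  shows "{x, y} \<in> edges (circulant n S) \<longleftrightarrow> (int y - int x) mod int n \<in> jumps n S"
proof -
  have "{x, y} \<in> edges (circulant n S) \<longleftrightarrow> (\<exists>s\<in>S. y = (x + s) mod n \<or> x = (y + s) mod n)"
    using assms by (auto simp: circulant_def doubleton_eq_iff)
  also have "\<dots> \<longleftrightarrow> (\<exists>s\<in>S. int n dvd (int y - int x) - int s \<or> int n dvd (int y - int x) + int s)"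
  proof -
    have "int n dvd (int x - int y) - int s \<longleftrightarrow> int n dvd (int y - int x) + int s" for s
      by (subst dvd_minus_iff[symmetric]) (simp add: algebra_simps)
    then show ?thesis
      using assms by (simp add: nat_eq_add_mod_iff)
  qed
  also have "\<dots> \<longleftrightarrow> (int y - int x) mod int n \<in> jumps n S"
    using assms by (simp add: mod_in_jumps_iff)
  finally show ?thesis .
qed

lemma edge_complement_circulant_iff:
  "{x, y} \<in> edges (complement (circulant n S)) \<longleftrightarrow>
     x < n \<and> y < n \<and> x \<noteq> y \<and> (int y - int x) mod int n \<notin> jumps n S"
proof -
  have "{x, y} \<in> edges (complement (circulant n S)) \<longleftrightarrow>
     x < n \<and> y < n \<and> x \<noteq> y \<and> {x, y} \<notin> edges (circulant n S)"
    by (auto simp: complement_def circulant_def doubleton_eq_iff insert_commute)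
  then show ?thesis
    using edge_circulant_iff by blast
qed

lemma verts_complement_circulant [simp]: "verts (complement (circulant n S)) = {..<n}"
  by (simp add: complement_def circulant_def)

lemma edge_complement_circulantE:
  assumes "e \<in> edges (complement (circulant n S))"
  obtains u v where "e = {u, v}" "u < n" "v < n" "u \<noteq> v"
  using assms by (auto simp: complement_def circulant_def)

lemma finite_edges_complement_circulant [simp]: "finite (edges (complement (circulant n S)))"
  by (rule finite_subset[of _ "Pow {..<n}"]) (auto elim!: edge_complement_circulantE)

lemma card_edge_complement_circulant:
  "e \<in> edges (complement (circulant n S)) \<Longrightarrow> card e = 2"
  by (auto elim!: edge_complement_circulantE)

text \<open>An ordered pair of distinct vertices is either adjacent, which counts every edge twice, or of the
  form \<open>(x, x + t)\<close> for exactly one jump \<open>t\<close>.\<close>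

lemma card_edges_complement_circulant:
  assumes "0 \<notin> jumps n S"
  shows "2 * card (edges (complement (circulant n S))) + n * card (jumps n S) = n * (n - 1)"
proof -
  let ?E = "edges (complement (circulant n S))" and ?J = "jumps n S"
  let ?A = "{(x, y). x \<noteq> y \<and> {x, y} \<in> ?E}"
  let ?f = "\<lambda>(x, t). (x, nat ((int x + t) mod int n))"
  let ?N = "?f ` ({..<n} \<times> ?J)"
  have J: "t mod int n = t" if "t \<in> ?J" for t
    using that by (auto simp: jumps_def)
  have diff: "(int (nat ((int x + t) mod int n)) - int x) mod int n = t" if "x < n" "t \<in> ?J" for x t
    using that J[OF that(2)] by (simp add: mod_diff_left_eq)
  have inj: "inj_on ?f ({..<n} \<times> ?J)"
  proof (rule inj_onI, clarsimp)
    fix x t t' assume "x < n" "t \<in> ?J" "t' \<in> ?J"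
      "nat ((int x + t) mod int n) = nat ((int x + t') mod int n)"
    then show "t = t'" using diff by metis
  qed
  have "ordered_pairs {..<n} = ?A \<union> ?N"
  proof (intro equalityI subsetI)
    fix p assume "p \<in> ordered_pairs {..<n}"
    then obtain x y where p: "p = (x, y)" "x < n" "y < n" "x \<noteq> y"
      by (auto simp: ordered_pairs_def)
    let ?t = "(int y - int x) mod int n"
    have "p = ?f (x, ?t)"
      using p by (simp add: mod_add_right_eq)
    then have "?t \<in> ?J \<Longrightarrow> p \<in> ?N"
      using p(2) by (metis (no_types, lifting) SigmaI imageI lessThan_iff)
    then show "p \<in> ?A \<union> ?N"
      using p(2-4)
      by (cases "?t \<in> ?J") (auto simp: p(1) edge_complement_circulant_iff simp del: image_iff)
  next
    fix p assume "p \<in> ?A \<union> ?N"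
    then show "p \<in> ordered_pairs {..<n}"
    proof
      assume "p \<in> ?A"
      then show ?thesis by (auto simp: edge_complement_circulant_iff ordered_pairs_def)
    next
      assume "p \<in> ?N"
      then obtain x t where p: "p = ?f (x, t)" "x < n" "t \<in> ?J" by auto
      moreover have "nat ((int x + t) mod int n) < n"
        using p(2) by (simp add: nat_less_iff)
      moreover have "nat ((int x + t) mod int n) \<noteq> x"
      proof
        assume "nat ((int x + t) mod int n) = x"
        then have "(int x - int x) mod int n = t"
          using diff[OF p(2,3)] by metis
        then show False using assms p(3) by simp
      qed
      ultimately show ?thesis by (auto simp: ordered_pairs_def)
    qed
  qed
  moreover have "?A \<inter> ?N = {}"
    using diff by (auto simp: edge_complement_circulant_iff)
  moreover have "finite ?A"
    by (rule finite_subset[of _ "{..<n} \<times> {..<n}"]) (auto simp: edge_complement_circulant_iff)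
  ultimately have "card (ordered_pairs {..<n}) = card ?A + card ?N"
    by (simp add: card_Un_disjoint)
  also have "card ?N = n * card ?J"
    using inj by (simp add: card_image card_cartesian_product)
  also have "card ?A = 2 * card ?E"
    by (rule card_adjacent_pairs) (auto simp: card_edge_complement_circulant)
  finally show ?thesis
    by (simp add: card_ordered_pairs)
qed

definition detour_routing :: "nat \<Rightarrow> int set \<Rightarrow> (int \<Rightarrow> int) \<Rightarrow> nat \<Rightarrow> nat \<Rightarrow> nat list" where
  "detour_routing n J c x y =
     (let t = (int y - int x) mod int n
      in if t \<in> J then [x, nat ((int x + c t) mod int n), y] else [x, y])"

lemma path_edges_eq_image:
  "path_edges p = (\<lambda>i. {p ! i, p ! Suc i}) ` {i. Suc i < length p}"
  unfolding path_edges_def by (rule setcompr_eq_image)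

lemma path_edges_pair: "path_edges [x, y] = {{x, y}}"
proof -
  have "{i. Suc i < length [x, y]} = {0}"
    by auto
  then show ?thesis
    by (simp only: path_edges_eq_image) simp
qed

lemma path_edges_triple: "path_edges [x, m, y] = {{x, m}, {m, y}}"
proof -
  have "{i. Suc i < length [x, m, y]} = {0, 1}"
    by auto
  then show ?thesis
    by (simp only: path_edges_eq_image) simp
qed

text \<open>A nonzero residue that is its own negative can only be \<open>n / 2\<close>. This is what prevents a detour
  pattern from using one edge in both directions.\<close>

lemma double_difference_mod_eq:
  fixes u v n :: nat
  assumes "u < n" "v < n" "u \<noteq> v" "(int u - int v) mod int n = (int v - int u) mod int n"
  shows "2 * ((int v - int u) mod int n) = int n"
proof -
  define w where "w = int v - int u"
  have w: "w \<noteq> 0" "w < int n" "- int n < w"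
    using assms(1-3) by (auto simp: w_def)
  have eq: "(- w) mod int n = w mod int n"
    using assms(4) by (simp add: w_def)
  have "2 * (w mod int n) = int n"
  proof (cases "w > 0")
    case True
    have "(- w) mod int n = (- w + int n) mod int n" by simp
    also have "\<dots> = - w + int n"
      using True w by (intro mod_pos_pos_trivial) auto
    finally show ?thesis using eq True w by simp
  next
    case False
    have "w mod int n = (w + int n) mod int n" by simp
    also have "\<dots> = w + int n"
      using False w by (intro mod_pos_pos_trivial) auto
    finally show ?thesis using eq False w by simp
  qed
  then show ?thesis by (simp add: w_def)
qed

lemma routing_detour_routing:
  assumes n: "n > 0"
    and c: "\<And>t. t \<in> jumps n S \<Longrightarrow> c t mod int n \<notin> insert 0 (jumps n S)"
           "\<And>t. t \<in> jumps n S \<Longrightarrow> (t - c t) mod int n \<notin> insert 0 (jumps n S)"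
  shows "routing (complement (circulant n S)) (detour_routing n (jumps n S) c)"
  unfolding routing_def
proof (intro ballI impI)
  let ?G = "complement (circulant n S)" and ?J = "jumps n S"
  fix x y assume "x \<in> verts ?G" "y \<in> verts ?G" and ne: "x \<noteq> y"
  then have xy: "x < n" "y < n" by auto
  define t where "t = (int y - int x) mod int n"
  show "elementary_path ?G x y (detour_routing n ?J c x y)"
  proof (cases "t \<in> ?J")
    case False
    then show ?thesis
      using xy ne unfolding t_def
      by (simp add: detour_routing_def elementary_path_def path_edges_pair edge_complement_circulant_iff)
  next
    case True
    define m where "m = nat ((int x + c t) mod int n)"
    have im: "int m = (int x + c t) mod int n" using n by (simp add: m_def)
    then have "m < n" using n by (metis of_nat_0_less_iff of_nat_less_iff pos_mod_bound)
    have xm: "(int m - int x) mod int n = c t mod int n"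
      by (simp add: im mod_diff_left_eq)
    have my: "(int y - int m) mod int n = (t - c t) mod int n"
      unfolding im t_def by (simp add: mod_diff_left_eq mod_diff_right_eq algebra_simps)
    have "m \<noteq> x" "m \<noteq> y"
      using xm my c[OF True] by auto
    then have "{x, m} \<in> edges ?G" "{m, y} \<in> edges ?G"
      using xm my c[OF True] xy \<open>m < n\<close> by (auto simp: edge_complement_circulant_iff)
    moreover have "detour_routing n ?J c x y = [x, m, y]"
      using True by (simp add: detour_routing_def m_def t_def Let_def)
    ultimately show ?thesis
      using ne \<open>m \<noteq> x\<close> \<open>m \<noteq> y\<close> \<open>m < n\<close> xy by (auto simp: elementary_path_def path_edges_triple)
  qed
qed

text \<open>The pairs whose path uses the edge \<open>{u, v}\<close> are covered by the two direct ones and, for each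
  jump \<open>t\<close>, one pair for either position of \<open>{u, v}\<close> on a detour. The direction in which such a
  detour traverses \<open>{u, v}\<close> is determined by \<open>t\<close>, since \<open>v - u\<close> and \<open>u - v\<close> differ modulo \<open>n\<close>.\<close>

lemma load_detour_routing_le:
  assumes n: "n > 0"
    and half: "even n \<Longrightarrow> int n div 2 \<in> jumps n S"
    and e: "e \<in> edges (complement (circulant n S))"
  shows "load (complement (circulant n S)) (detour_routing n (jumps n S) c) e
           \<le> 2 + 2 * card (jumps n S)"
proof -
  let ?G = "complement (circulant n S)" and ?J = "jumps n S"
  let ?r = "\<lambda>z. nat (z mod int n)"
  obtain u v where uv: "e = {u, v}" "u < n" "v < n" "u \<noteq> v"
    using e by (rule edge_complement_circulantE)
  define d where "d = (int v - int u) mod int n"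
  have "d \<notin> ?J"
    using e uv by (simp add: d_def edge_complement_circulant_iff)
  have rev: "(int u - int v) mod int n \<noteq> d"
  proof
    assume "(int u - int v) mod int n = d"
    then have "2 * d = int n"
      using double_difference_mod_eq[OF uv(2-4)] by (simp add: d_def)
    then have "even (int n)" "d = int n div 2"
      by (auto simp flip: \<open>2 * d = int n\<close>)
    then show False
      using half \<open>d \<notin> ?J\<close> by simp
  qed
  \<comment> \<open>The end points of the path for \<open>t\<close> whose first (second) edge is \<open>{u, v}\<close>. The test fixes the
      direction; its second branch is only meaningful if the step is \<open>u - v\<close>.\<close>
  define first where
    "first t = (if c t mod int n = d then (u, ?r (int u + t)) else (v, ?r (int v + t)))" for t
  define second where
    "second t = (if (t - c t) mod int n = d then (?r (int v - t), v) else (?r (int u - t), u))" for t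
  have "{(x, y). x \<in> verts ?G \<and> y \<in> verts ?G \<and> x \<noteq> y \<and> e \<in> path_edges (detour_routing n ?J c x y)}
          \<subseteq> {(u, v), (v, u)} \<union> (first ` ?J \<union> second ` ?J)" (is "?L \<subseteq> ?U")
  proof (rule subsetI)
    fix p assume "p \<in> ?L"
    then obtain x y where p: "p = (x, y)" and xy: "x < n" "y < n" "x \<noteq> y"
      and ein: "e \<in> path_edges (detour_routing n ?J c x y)" by auto
    define t where "t = (int y - int x) mod int n"
    show "p \<in> ?U"
    proof (cases "t \<in> ?J")
      case False
      then have "{u, v} = {x, y}"
        using ein uv(1) by (simp add: detour_routing_def t_def path_edges_pair)
      then show ?thesis using p by (auto simp: doubleton_eq_iff)
    next
      case True
      define m where "m = ?r (int x + c t)"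
      have im: "int m = (int x + c t) mod int n" using n by (simp add: m_def)
      have xm: "(int m - int x) mod int n = c t mod int n"
        by (simp add: im mod_diff_left_eq)
      have my: "(int y - int m) mod int n = (t - c t) mod int n"
        unfolding im t_def by (simp add: mod_diff_left_eq mod_diff_right_eq algebra_simps)
      have y: "?r (int x + t) = y"
        using xy by (simp add: t_def mod_add_right_eq)
      have x: "?r (int y - t) = x"
        using xy by (simp add: t_def mod_diff_right_eq)
      have "detour_routing n ?J c x y = [x, m, y]"
        using True by (simp add: detour_routing_def m_def t_def Let_def)
      then have "{u, v} = {x, m} \<or> {u, v} = {m, y}"
        using ein uv(1) by (simp add: path_edges_triple)
      then have "(x = u \<and> m = v \<or> x = v \<and> m = u) \<or> (m = u \<and> y = v \<or> m = v \<and> y = u)"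
        by (auto simp: doubleton_eq_iff)
      then have "first t = p \<or> second t = p"
      proof
        assume "x = u \<and> m = v \<or> x = v \<and> m = u"
        then have "first t = p"
          using xm y rev unfolding first_def p d_def by auto
        then show ?thesis ..
      next
        assume "m = u \<and> y = v \<or> m = v \<and> y = u"
        then have "second t = p"
          using my x rev unfolding second_def p d_def by auto
        then show ?thesis ..
      qed
      then show ?thesis using True by blast
    qed
  qed
  then have "card ?L \<le> card ?U"
    by (intro card_mono) auto
  also have "\<dots> \<le> 2 + (card ?J + card ?J)"
    using card_Un_le[of "{(u, v), (v, u)}" "first ` ?J \<union> second ` ?J"]
      card_Un_le[of "first ` ?J" "second ` ?J"]
      card_image_le[of ?J first] card_image_le[of ?J second] uv(4) by simp
  finally show ?thesis
    by (simp add: load_def)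
qed

section \<open>The jumps \<open>\<plusminus> 2 ^ i\<close> modulo \<open>2 ^ h\<close>\<close>

lemma jumps_powers_of_two:
  assumes "h \<ge> 1"
  shows "jumps (2 ^ h) {2 ^ i | i. i < h} =
           (\<lambda>i. 2 ^ i) ` {..<h} \<union> (\<lambda>i. 2 ^ h - 2 ^ i) ` {..<h - 1}" (is "?J = ?U")
proof (intro equalityI subsetI)
  fix t assume "t \<in> ?J"
  then obtain i where t: "0 \<le> t" "t < 2 ^ h" and i: "i < h"
    and dvd: "2 ^ h dvd t - 2 ^ i \<or> 2 ^ h dvd t + 2 ^ i"
    by (auto simp: jumps_def)
  have less: "(0::int) < 2 ^ i" "(2::int) ^ i < 2 ^ h" using i by simp_all
  have "t = 2 ^ i \<or> t = 2 ^ h - 2 ^ i"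
    using dvd
  proof
    assume "2 ^ h dvd t - 2 ^ i"
    moreover have "\<bar>t - 2 ^ i\<bar> < 2 ^ h" using t less by linarith
    ultimately show ?thesis using dvd_imp_le_int[of "t - 2 ^ i" "2 ^ h"] by fastforce
  next
    assume "2 ^ h dvd t + 2 ^ i"
    then have "2 ^ h dvd t + 2 ^ i - 2 ^ h" by simp
    moreover have "\<bar>t + 2 ^ i - 2 ^ h\<bar> < 2 ^ h"
      using t less by linarith
    ultimately show ?thesis using dvd_imp_le_int[of "t + 2 ^ i - 2 ^ h" "2 ^ h"] by fastforce
  qed
  then show "t \<in> ?U"
  proof
    assume "t = 2 ^ i"
    then show ?thesis using i by blast
  next
    assume t: "t = 2 ^ h - 2 ^ i"
    show ?thesis
    proof (cases "i = h - 1")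
      case True
      then have "t = 2 ^ (h - 1)" using t assms by (cases h) auto
      then show ?thesis using assms by (intro UnI1 image_eqI[of _ _ "h - 1"]) auto
    next
      case False
      then show ?thesis using t i by auto
    qed
  qed
next
  fix t assume "t \<in> ?U"
  then obtain i where i: "i < h" and t: "t = 2 ^ i \<or> t = 2 ^ h - 2 ^ i"
  proof
    assume "t \<in> (\<lambda>i. 2 ^ h - 2 ^ i) ` {..<h - 1}"
    then obtain i where "i < h - 1" "t = 2 ^ h - 2 ^ i" by blast
    then show ?thesis using that[of i] by simp
  qed blast
  then have "(0::int) < 2 ^ i" "(2::int) ^ i < 2 ^ h" by simp_all
  then show "t \<in> ?J"
    using t i by (auto simp: jumps_def)
qed

text \<open>Two powers below \<open>2 ^ h\<close> add up to \<open>2 ^ h\<close> only if both are \<open>2 ^ (h - 1)\<close>. That jump is its own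
  negative and accounts for the \<open>- 1\<close>.\<close>

lemma card_jumps_powers_of_two:
  assumes "h \<ge> 1"
  shows "card (jumps (2 ^ h) {2 ^ i | i. i < h}) = 2 * h - 1"
proof -
  have "(2::int) ^ i \<noteq> 2 ^ h - 2 ^ j" if "i < h" "j < h - 1" for i j
  proof -
    have "(2::int) ^ i \<le> 2 ^ (h - 1)" "(2::int) ^ j < 2 ^ (h - 1)"
      using that by auto
    moreover have "(2::int) ^ h = 2 * 2 ^ (h - 1)"
      using assms by (cases h) auto
    ultimately show ?thesis by linarith
  qed
  then have disj: "(\<lambda>i. 2 ^ i :: int) ` {..<h} \<inter> (\<lambda>i. 2 ^ h - 2 ^ i) ` {..<h - 1} = {}"
    by blast
  have "inj_on (\<lambda>i. 2 ^ i :: int) {..<h}" "inj_on (\<lambda>i. 2 ^ h - 2 ^ i :: int) {..<h - 1}"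
    by (auto intro!: inj_onI)
  then show ?thesis
    using assms disj by (simp add: jumps_powers_of_two card_Un_disjoint card_image)
qed

text \<open>The differences \<open>z\<close> between adjacent vertices of the complement. Phrasing this by divisibility
  for arbitrary integers, without reduction modulo \<open>2 ^ h\<close>, lets small and negative steps be checked
  modulo \<open>16\<close> for all \<open>h\<close> at once.\<close>

definition edge_step :: "nat \<Rightarrow> int \<Rightarrow> bool" where
  "edge_step h z \<longleftrightarrow> \<not> 2 ^ h dvd z \<and> (\<forall>i<h. \<not> 2 ^ h dvd z - 2 ^ i \<and> \<not> 2 ^ h dvd z + 2 ^ i)"

lemma mod_notin_insert_0_jumps_iff:
  "z mod int (2 ^ h) \<notin> insert 0 (jumps (2 ^ h) {2 ^ i | i. i < h}) \<longleftrightarrow> edge_step h z"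
proof -
  have "z mod int (2 ^ h) \<in> jumps (2 ^ h) {2 ^ i | i. i < h} \<longleftrightarrow>
      (\<exists>i<h. 2 ^ h dvd z - 2 ^ i \<or> 2 ^ h dvd z + 2 ^ i)"
    by (subst mod_in_jumps_iff) auto
  then show ?thesis
    unfolding insert_iff edge_step_def by (simp add: dvd_eq_mod_eq_0)
qed

lemma edge_step_minus: "edge_step h (- z) \<longleftrightarrow> edge_step h z"
proof -
  have "2 ^ h dvd - z - 2 ^ i \<longleftrightarrow> 2 ^ h dvd z + 2 ^ i" "2 ^ h dvd - z + 2 ^ i \<longleftrightarrow> 2 ^ h dvd z - 2 ^ i" for i
    by (subst dvd_minus_iff[symmetric], simp add: algebra_simps)+
  then show ?thesis by (auto simp: edge_step_def)
qed

text \<open>By parity, an odd step can only collide with the jumps \<open>\<plusminus> 2 ^ 0\<close>.\<close>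

lemma edge_step_odd:
  assumes "odd z" "h \<ge> 1" "\<not> 2 ^ h dvd z - 1" "\<not> 2 ^ h dvd z + 1"
  shows "edge_step h z"
proof -
  have even: "even w" if "2 ^ h dvd w" for w :: int
    using that assms(2) dvd_trans[OF dvd_power[of h "2::int"]] by force
  have "\<not> 2 ^ h dvd z - 2 ^ i \<and> \<not> 2 ^ h dvd z + 2 ^ i" for i
    using even[of "z - 2 ^ i"] even[of "z + 2 ^ i"] assms by (cases i) auto
  then show ?thesis
    using even[of z] assms(1) by (auto simp: edge_step_def)
qed

text \<open>An even power is split into two odd steps. For \<open>2 ^ i\<close> with \<open>i \<ge> 3\<close> the step \<open>3\<close> serves, as
  \<open>2 ^ i - 3\<close> is \<open>5\<close> modulo \<open>8\<close>; for \<open>2\<close> and \<open>4\<close> it would leave \<open>\<plusminus> 1\<close>, which is a jump. One of the two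
  steps adding up to \<open>1\<close> must be even, and \<open>6\<close> is the smallest positive even number that is not a jump; \<open>6\<close> is
  the negative of \<open>2\<close> modulo \<open>8\<close>, which is why \<open>h\<close> has to be at least \<open>4\<close>.\<close>

lemma ex_splitting_power_of_two:
  assumes "h \<ge> 4" "i < h"
  shows "\<exists>c. edge_step h c \<and> edge_step h (2 ^ i - c)"
proof -
  have dvd16: "16 dvd z" if "2 ^ h dvd z" for z :: int
  proof -
    have "(2::int) ^ 4 dvd 2 ^ h" using assms(1) by (rule le_imp_power_dvd)
    then show ?thesis using that dvd_trans by fastforce
  qed
  have small: "edge_step h z" if "z \<in> {3, 5, 7, - 3, - 5}" for z
  proof (rule edge_step_odd)
    show "odd z" "h \<ge> 1" using that assms by auto
    show "\<not> 2 ^ h dvd z - 1" "\<not> 2 ^ h dvd z + 1"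
      using that dvd16[of "z - 1"] dvd16[of "z + 1"] by auto
  qed
  consider "i = 0" | "i = 1" | "i = 2" | "i \<ge> 3" by linarith
  then show ?thesis
  proof cases
    case 1
    have "edge_step h 6"
    proof -
      have "\<not> 16 dvd 6 - (2::int) ^ j \<and> \<not> 16 dvd 6 + (2::int) ^ j" for j
      proof (cases "j < 4")
        case True
        then have "j \<in> {0, 1, 2, 3}" by auto
        then show ?thesis by auto
      next
        case False
        then have "(2::int) ^ 4 dvd 2 ^ j" by (intro le_imp_power_dvd) simp
        then have "(16::int) dvd 2 ^ j" by simp
        then show ?thesis
          by (auto simp: dvd_add_left_iff dvd_diff_left_iff)
      qed
      then show ?thesis
        using dvd16 by (force simp: edge_step_def)
    qed
    then show ?thesis using 1 small[of "- 5"] by (intro exI[of _ 6]) auto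
  next
    case 2
    then show ?thesis using small by (intro exI[of _ 5]) auto
  next
    case 3
    then show ?thesis using small by (intro exI[of _ 7]) auto
  next
    case 4
    have "(2::int) ^ 3 dvd 2 ^ i" using 4 by (rule le_imp_power_dvd)
    then have i8: "(8::int) dvd 2 ^ i" by simp
    have "edge_step h (2 ^ i - 3)"
    proof (rule edge_step_odd)
      show "odd ((2::int) ^ i - 3)" "h \<ge> 1" using 4 assms by auto
      have "8 dvd z" if "2 ^ h dvd z" for z :: int
        using dvd16[OF that] by presburger
      moreover have "\<not> 8 dvd (2::int) ^ i - 3 - 1" "\<not> 8 dvd (2::int) ^ i - 3 + 1"
        using i8 by presburger+
      ultimately show "\<not> 2 ^ h dvd (2::int) ^ i - 3 - 1" "\<not> 2 ^ h dvd (2::int) ^ i - 3 + 1"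
        by blast+
    qed
    then show ?thesis using small by (intro exI[of _ 3]) auto
  qed
qed

text \<open>A splitting of \<open>2 ^ i\<close> becomes one of \<open>- 2 ^ i\<close> by negating both steps.\<close>

lemma ex_splitting_jump:
  assumes "h \<ge> 4" "t \<in> jumps (2 ^ h) {2 ^ i | i. i < h}"
  shows "\<exists>c. edge_step h c \<and> edge_step h (t - c)"
proof -
  obtain i where i: "i < h" "t = 2 ^ i \<or> t = 2 ^ h - 2 ^ i"
  proof -
    have "t \<in> (\<lambda>i. 2 ^ i) ` {..<h} \<union> (\<lambda>i. 2 ^ h - 2 ^ i) ` {..<h - 1}"
      using assms by (simp add: jumps_powers_of_two)
    then show ?thesis
    proof
      assume "t \<in> (\<lambda>i. 2 ^ h - 2 ^ i) ` {..<h - 1}"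
      then obtain i where "i < h - 1" "t = 2 ^ h - 2 ^ i" by blast
      then show ?thesis using that[of i] by simp
    qed (use that in blast)
  qed
  obtain c where c: "edge_step h c" "edge_step h (2 ^ i - c)"
    using ex_splitting_power_of_two[OF assms(1) i(1)] by blast
  have period: "edge_step h (2 ^ h + z) \<longleftrightarrow> edge_step h z" for z
    unfolding mod_notin_insert_0_jumps_iff[symmetric] by simp
  show ?thesis
    using i(2)
  proof
    assume "t = 2 ^ i"
    then show ?thesis using c by blast
  next
    assume t: "t = 2 ^ h - 2 ^ i"
    have "t - (- c) = 2 ^ h + (- (2 ^ i - c))"
      using t by simp
    then have "edge_step h (t - (- c))"
      using c(2) by (simp only: period edge_step_minus)
    then show ?thesis using c(1) edge_step_minus by blast
  qed
qed

text \<open>The edge count \<open>E\<close> is eliminated from the averaging bound, with \<open>M\<close> the maximal load of a routing.\<close>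

lemma averaging_quotient:
  fixes n h E M :: real
  assumes E: "2 * E = n * (n - 2 * h)" and le: "2 * (n * (n - 1)) \<le> (M + 2) * E"
    and pos: "0 < n" "0 < n - 2 * h"
  shows "2 * (n + 2 * h - 2) / (n - 2 * h) \<le> M"
proof -
  have "n * (4 * (n - 1)) = 2 * (2 * (n * (n - 1)))"
    by simp
  also have "\<dots> \<le> 2 * ((M + 2) * E)"
    using le by (rule mult_left_mono) simp
  also have "\<dots> = (M + 2) * (2 * E)"
    by (rule mult.left_commute)
  also have "\<dots> = n * ((M + 2) * (n - 2 * h))"
    unfolding E by (rule mult.left_commute)
  finally have "4 * (n - 1) \<le> (M + 2) * (n - 2 * h)"
    using pos(1) by (rule mult_left_le_imp_le)
  also have "\<dots> = M * (n - 2 * h) + 2 * (n - 2 * h)"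
    by (rule distrib_right)
  finally have "2 * (n + 2 * h - 2) \<le> M * (n - 2 * h)"
    by simp
  then show ?thesis
    using pos(2) by (simp only: pos_divide_le_eq)
qed

theorem corollary5p5:
  fixes h n :: nat
  assumes "h \<ge> 4" and "n = 2 ^ h"
  shows "2 * (real n + 2 * real h - 2) / (real n - 2 * real h)
           \<le> real (edge_forwarding_index (complement (circulant n {2 ^ i | i. i < h})))
       \<and> real (edge_forwarding_index (complement (circulant n {2 ^ i | i. i < h})))
           \<le> 6 * real h - 1"
proof -
  let ?S = "{2 ^ i | i. i < h} :: nat set"
  let ?J = "jumps n ?S" and ?G = "complement (circulant n ?S)"
  have cardJ: "card ?J = 2 * h - 1"
    using assms by (simp add: card_jumps_powers_of_two)
  have J0: "0 \<notin> ?J"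
  proof
    assume "0 \<in> ?J"
    then obtain i where "i < h" "(2::int) ^ h = 2 ^ i"
      using assms by (auto simp: jumps_powers_of_two)
    then show False by simp
  qed
  have "\<forall>t\<in>?J. \<exists>c. edge_step h c \<and> edge_step h (t - c)"
    using ex_splitting_jump[OF assms(1)] unfolding assms(2) by blast
  from bchoice[OF this]
  obtain c where c: "\<And>t. t \<in> ?J \<Longrightarrow> edge_step h (c t) \<and> edge_step h (t - c t)"
    by blast
  let ?R = "detour_routing n ?J c"
  have n: "n > 0" using assms by simp
  note c' = c[THEN conjunct1, folded mod_notin_insert_0_jumps_iff, folded assms(2)]
    c[THEN conjunct2, folded mod_notin_insert_0_jumps_iff, folded assms(2)]
  have R: "routing ?G ?R"
    using n c' by (rule routing_detour_routing)
  have half: "int n div 2 \<in> ?J"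
  proof -
    have "int n div 2 = 2 ^ (h - 1)" using assms by (cases h) auto
    then show ?thesis using assms by (simp add: jumps_powers_of_two)
  qed
  have load: "load ?G ?R e \<le> 4 * h" if "e \<in> edges ?G" for e
    using load_detour_routing_le[OF n half that, where c = c] cardJ assms(1) by simp

  have big: "2 * h < n"
    unfolding assms(2) using assms(1)
    by (induction h rule: dec_induct) auto
  have "2 * card (edges ?G) + n * (2 * h - 1) = n * (n - 1)"
    using card_edges_complement_circulant[OF J0] cardJ by simp
  then have "real (2 * card (edges ?G) + n * (2 * h - 1)) = real (n * (n - 1))"
    by (rule arg_cong)
  moreover have minus_1: "real (2 * h - 1) = 2 * real h - 1" "real (n - 1) = real n - 1"
    using assms(1) n by (simp_all add: of_nat_diff)
  ultimately have cardE: "2 * real (card (edges ?G)) = real n * (real n - 2 * real h)"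
    unfolding of_nat_add of_nat_mult of_nat_numeral minus_1 by (simp add: algebra_simps)
  have big_real: "0 < real n - 2 * real h"
    using big by simp
  have ne: "edges ?G \<noteq> {}"
    using cardE big n by auto

  have upper: "edge_forwarding_index ?G \<le> 4 * h"
    using R load ne by (intro edge_forwarding_index_le) auto

  obtain R' where R': "routing ?G R'" "edge_forwarding_index ?G = max_load ?G R'"
    using edge_forwarding_index_attained[OF R] .
  have "2 * (n * (n - 1)) \<le> (max_load ?G R' + 2) * card (edges ?G)"
    using two_pairs_le_max_load_mult_edges[OF _ _ R'(1)] by (simp add: card_edge_complement_circulant)
  then have "real (2 * (n * (n - 1))) \<le> real ((max_load ?G R' + 2) * card (edges ?G))"
    by (rule of_nat_mono)
  then have "2 * (real n * (real n - 1)) \<le> (real (max_load ?G R') + 2) * real (card (edges ?G))"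
    by (simp only: of_nat_add of_nat_mult of_nat_numeral minus_1)
  then have "2 * (real n + 2 * real h - 2) / (real n - 2 * real h) \<le> real (max_load ?G R')"
    using averaging_quotient[OF cardE _ _ big_real] n by simp
  moreover have "real (4 * h) \<le> 6 * real h - 1"
    using assms(1) by simp
  ultimately show ?thesis
    unfolding R'(2)[symmetric] using of_nat_mono[OF upper, where 'a = real] by (intro conjI) linarith+
qed

end
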